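(* Let $G$ and $G'$ be looped simple graphs, and let $f:V(G)\to V(G')$ be a bijection. Then the following are equivalent. 1. $f$ is an isomorphism of graphs. 2. For every $S\subseteq V(G)$, $f$ (restricted to $S$) defines an isomorphism $M_A(G[S])\cong M_A(G'[f(S)])$ of matroids. 3. For every $S\subseteq V(G)$ with $|S|\le 2$, the matroids $M_A(G[S])$ and $M_A(G'[f(S)])$ have the same nullity.
   Context: Graphs are finite. A looped simple graph is a graph with no parallel edges and at most one loop at each vertex (loops are allowed). $G[S]$ is the full subgraph of $G$ induced by $S$ (vertex set $S$, all edges and loops of $G$ with all ends in $S$). $\mathcal{A}(G)$ is the symmetric $V(G)\times V(G)$ matrix over $GF(2)$ whose diagonal entry $a_{vv}$ is $1$ iff $v$ is looped, and whose off-diagonal entry $a_{vw}$ is $1$ iff $v\neq w$ are adjacent. The adjacency matroid $M_A(G)$ is the binary matroid on $V(G)$ represented by $\mathcal{A}(G)$: its circuits are the minimal nonempty subsets $S\subseteq V(G)$ such that the columns of $\mathcal{A}(G)$ corresponding to elements of $S$ are linearly dependent over $GF(2)$. The nullity of a matroid is the size of its ground set minus its rank; for $M_A(G)$ it is the $GF(2)$-nullity of $\mathcal{A}(G)$. A bijection of ground sets defines a matroid isomorphism if the families of circuits correspond under it. *)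

theory Defs
  imports "HOL-Library.Z2" "Graph_Theory.Graph_Theory"
begin

text \<open>
  A looped simple graph is a \<^locale>\<open>pair_pseudo_graph\<close>: a finite symmetric digraph whose arcs are
  pairs of vertices. The edge joining \<open>v \<noteq> w\<close> is the pair of arcs \<open>(v, w)\<close>, \<open>(w, v)\<close>, a loop at \<open>v\<close>
  is the arc \<open>(v, v)\<close>, and parallel edges cannot occur. The full subgraph induced by a vertex set
  \<open>S\<close> is \<open>with_proj G \<restriction> S\<close>, so notions applied to subgraphs are defined for \<^typ>\<open>('a, 'b) pre_digraph\<close>.
\<close>

text \<open>Taking \<open>v = w\<close> below makes \<open>f\<close> preserve and reflect loops.\<close>

definition graph_isomorphism ::
    "('a, 'b) pre_digraph \<Rightarrow> ('c, 'd) pre_digraph \<Rightarrow> ('a \<Rightarrow> 'c) \<Rightarrow> bool" where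
  "graph_isomorphism G H f \<longleftrightarrow>
     bij_betw f (verts G) (verts H) \<and>
     (\<forall>v \<in> verts G. \<forall>w \<in> verts G. v \<rightarrow>\<^bsub>G\<^esub> w \<longleftrightarrow> f v \<rightarrow>\<^bsub>H\<^esub> f w)"

text \<open>For looped simple graphs this is isomorphism in the sense of \<^const>\<open>app_iso\<close>.\<close>

lemma graph_isomorphism_iff_app_iso:
  assumes "pair_pseudo_graph G" and "pair_pseudo_graph H"
  shows "graph_isomorphism (with_proj G) (with_proj H) f \<longleftrightarrow>
    (\<exists>h. iso_verts h = f \<and> pre_digraph.digraph_isomorphism (with_proj G) h \<and>
         with_proj H = app_iso h (with_proj G))"
proof -
  interpret G: pair_pseudo_graph G by fact
  interpret H: pair_pseudo_graph H by fact
  show ?thesis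
  proof
    assume iso: "graph_isomorphism (with_proj G) (with_proj H) f"
    then have inj: "inj_on f (pverts G)" and im: "f ` pverts G = pverts H"
      and adj: "\<And>v w. v \<in> pverts G \<Longrightarrow> w \<in> pverts G \<Longrightarrow>
        (v, w) \<in> parcs G \<longleftrightarrow> (f v, f w) \<in> parcs H"
      unfolding graph_isomorphism_def bij_betw_def with_proj_simps by blast+
    define h where "h = \<lparr>iso_verts = f, iso_arcs = map_prod f f, iso_head = snd, iso_tail = fst\<rparr>"
    have "map_prod f f ` parcs G = parcs H"
    proof (intro equalityI subsetI)
      fix e assume "e \<in> map_prod f f ` parcs G"
      then obtain v w where "(v, w) \<in> parcs G" "e = (f v, f w)" by auto
      then show "e \<in> parcs H" using adj G.wellformed' by blast
    next
      fix e assume e: "e \<in> parcs H"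
      obtain x y where xy: "e = (x, y)" by (cases e)
      with e have "x \<in> f ` pverts G" "y \<in> f ` pverts G"
        using H.wellformed' im by blast+
      then obtain v w where "v \<in> pverts G" "w \<in> pverts G" "x = f v" "y = f w" by auto
      with xy e adj have "(v, w) \<in> parcs G" "e = map_prod f f (v, w)" by auto
      then show "e \<in> map_prod f f ` parcs G" by blast
    qed
    moreover have "inj_on (map_prod f f) (parcs G)"
    proof (rule inj_onI)
      fix a b assume ab: "a \<in> parcs G" "b \<in> parcs G" "map_prod f f a = map_prod f f b"
      obtain v w x y where "a = (v, w)" "b = (x, y)" by (cases a, cases b)
      then show "a = b"
        using ab G.wellformed'[of v w] G.wellformed'[of x y] inj_onD[OF inj, of v x]
          inj_onD[OF inj, of w y] by simp
    qed
    ultimately have "pre_digraph.digraph_isomorphism (with_proj G) h"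
      and "with_proj H = app_iso h (with_proj G)"
      using inj im[symmetric] G.wf_digraph_axioms
      by (auto simp add: h_def pre_digraph.digraph_isomorphism_def app_iso_def with_proj_def)
    then show "\<exists>h. iso_verts h = f \<and> pre_digraph.digraph_isomorphism (with_proj G) h \<and>
        with_proj H = app_iso h (with_proj G)"
      by (intro exI[of _ h]) (simp add: h_def)
  next
    assume "\<exists>h. iso_verts h = f \<and> pre_digraph.digraph_isomorphism (with_proj G) h \<and>
        with_proj H = app_iso h (with_proj G)"
    then obtain h where h: "iso_verts h = f" "pre_digraph.digraph_isomorphism (with_proj G) h"
      and H: "with_proj H = app_iso h (with_proj G)" by blast
    have verts: "pverts H = f ` pverts G" and arcs: "parcs H = iso_arcs h ` parcs G"
      and "fst = iso_tail h" "snd = iso_head h"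
      using H h(1) by (auto simp: with_proj_def app_iso_def)
    moreover have inj: "inj_on f (pverts G)"
      using h by (auto simp: pre_digraph.digraph_isomorphism_def)
    ultimately have arc: "iso_arcs h e = map_prod f f e" if "e \<in> parcs G" for e
      using h that by (auto simp: pre_digraph.digraph_isomorphism_def prod_eq_iff)
    have im: "parcs H = map_prod f f ` parcs G"
      using arcs arc by (auto intro!: image_cong)
    have "(v, w) \<in> parcs G \<longleftrightarrow> (f v, f w) \<in> parcs H"
      if vw: "v \<in> pverts G" "w \<in> pverts G" for v w
    proof
      assume "(v, w) \<in> parcs G"
      then have "map_prod f f (v, w) \<in> parcs H" unfolding im by (rule imageI)
      then show "(f v, f w) \<in> parcs H" by simp
    next
      assume "(f v, f w) \<in> parcs H"
      then obtain a b where ab: "(a, b) \<in> parcs G" "f v = f a" "f w = f b"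
        unfolding im by auto
      then have "v = a" "w = b"
        using inj_onD[OF inj] vw G.wellformed' by blast+
      with ab show "(v, w) \<in> parcs G" by simp
    qed
    with inj verts show "graph_isomorphism (with_proj G) (with_proj H) f"
      unfolding graph_isomorphism_def bij_betw_def with_proj_simps by blast
  qed
qed

definition adjacency_matrix :: "('a, 'b) pre_digraph \<Rightarrow> 'a \<Rightarrow> 'a \<Rightarrow> bit" where
  "adjacency_matrix G v w = of_bool (v \<rightarrow>\<^bsub>G\<^esub> w)"

text \<open>
  Linear dependence of the family of columns \<open>(A _ v)\<close>, \<open>v \<in> S\<close>, of a matrix with rows \<open>R\<close>. It is
  dependence of an indexed family: two equal columns with different indices are dependent.
\<close>

definition columns_dependent :: "'r set \<Rightarrow> ('r \<Rightarrow> 'a \<Rightarrow> 'k::field) \<Rightarrow> 'a set \<Rightarrow> bool" where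
  "columns_dependent R A S \<longleftrightarrow>
     (\<exists>c. (\<exists>v \<in> S. c v \<noteq> 0) \<and> (\<forall>u \<in> R. (\<Sum>v \<in> S. c v * A u v) = 0))"

text \<open>
  Matroids are given by their ground set and circuits. The record does not enforce the circuit
  axioms; they hold for the represented matroids below.
\<close>

record 'a matroid =
  ground :: "'a set"
  circuits :: "'a set set"

definition represented_matroid ::
    "'r set \<Rightarrow> 'a set \<Rightarrow> ('r \<Rightarrow> 'a \<Rightarrow> 'k::field) \<Rightarrow> 'a matroid" where
  "represented_matroid R E A =
     \<lparr>ground = E,
      circuits = {C. C \<subseteq> E \<and> C \<noteq> {} \<and> columns_dependent R A C \<and>
                     (\<forall>D. D \<subset> C \<and> D \<noteq> {} \<longrightarrow> \<not> columns_dependent R A D)}\<rparr>"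

definition adjacency_matroid :: "('a, 'b) pre_digraph \<Rightarrow> 'a matroid" where
  "adjacency_matroid G = represented_matroid (verts G) (verts G) (adjacency_matrix G)"

definition matroid_indep :: "'a matroid \<Rightarrow> 'a set \<Rightarrow> bool" where
  "matroid_indep M I \<longleftrightarrow> I \<subseteq> ground M \<and> (\<forall>C \<in> circuits M. \<not> C \<subseteq> I)"

definition matroid_rank :: "'a matroid \<Rightarrow> nat" where
  "matroid_rank M = Max (card ` {I. matroid_indep M I})"

definition matroid_nullity :: "'a matroid \<Rightarrow> nat" where
  "matroid_nullity M = card (ground M) - matroid_rank M"

definition matroid_isomorphism :: "'a matroid \<Rightarrow> 'b matroid \<Rightarrow> ('a \<Rightarrow> 'b) \<Rightarrow> bool" where
  "matroid_isomorphism M N f \<longleftrightarrow>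
     bij_betw f (ground M) (ground N) \<and> circuits N = (\<lambda>C. f ` C) ` circuits M"

end

theory Submission
  imports Defs
begin

text \<open>
  Relabelling the rows and columns of a matrix relabels the circuits of its matroid, so a graph
  isomorphism restricts to matroid isomorphisms on all full subgraphs
  (\<open>matroid_isomorphism_represented_matroid\<close>). An isomorphism of matroids matches up independent
  sets and hence preserves the nullity (\<open>matroid_nullity_eq_if_isomorphism\<close>).

  What remains is that the nullities on at most two vertices determine the graph. Only their
  vanishing matters: the nullity is zero iff the columns are independent
  (\<open>matroid_nullity_represented_eq_0_iff\<close>), which for one or two vertices says that a determinant is
  nonzero. For one vertex the determinant is the diagonal entry, so \<open>f\<close> preserves and reflects
  loops. For two vertices \<open>v \<noteq> w\<close> it is \<open>a\<^sub>v\<^sub>v a\<^sub>w\<^sub>w - a\<^sub>v\<^sub>w\<^sup>2\<close>, and over the field with two elements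
  \<open>a\<^sub>v\<^sub>w\<^sup>2 = a\<^sub>v\<^sub>w\<close>. Hence, once the loops are known, its vanishing tells whether \<open>v\<close> and \<open>w\<close> are
  adjacent.
\<close>

section \<open>Matroids represented by matrices\<close>

lemma columns_dependent_mono:
  assumes "columns_dependent R A S" "S \<subseteq> T" "finite T"
  shows "columns_dependent R A T"
proof -
  obtain c where c: "\<exists>v\<in>S. c v \<noteq> 0" "\<forall>u\<in>R. (\<Sum>v\<in>S. c v * A u v) = 0"
    using assms(1) unfolding columns_dependent_def by blast
  define d where "d v = (if v \<in> S then c v else 0)" for v
  have "(\<Sum>v\<in>T. d v * A u v) = (\<Sum>v\<in>S. c v * A u v)" for u
    by (rule sum.mono_neutral_cong_right) (use assms in \<open>auto simp: d_def\<close>)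
  moreover have "\<exists>v\<in>T. d v \<noteq> 0"
    using c(1) assms(2) by (auto simp: d_def)
  ultimately show ?thesis
    using c(2) unfolding columns_dependent_def by auto
qed

lemma not_columns_dependent_empty: "\<not> columns_dependent R A {}"
  by (simp add: columns_dependent_def)

lemma columns_dependent_imp_circuit:
  assumes "columns_dependent R A E" "finite E"
  obtains C where "C \<in> circuits (represented_matroid R E A)"
proof -
  let ?D = "{C. C \<subseteq> E \<and> columns_dependent R A C}"
  have "finite ?D" "?D \<noteq> {}"
    using assms by auto
  then obtain C where "C \<in> ?D" and min: "\<And>D. D \<in> ?D \<Longrightarrow> D \<subseteq> C \<Longrightarrow> C = D"
    using finite_has_minimal[of ?D] by metis
  then have "C \<subseteq> E" "columns_dependent R A C" "C \<noteq> {}"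
    using not_columns_dependent_empty by auto
  moreover have "\<not> columns_dependent R A D" if "D \<subset> C" for D
    using min[of D] that \<open>C \<subseteq> E\<close> by auto
  ultimately have "C \<in> circuits (represented_matroid R E A)"
    by (simp add: represented_matroid_def)
  then show ?thesis
    by (rule that)
qed

lemma matroid_indep_represented_ground_iff:
  assumes "finite E"
  shows "matroid_indep (represented_matroid R E A) E \<longleftrightarrow> \<not> columns_dependent R A E"
proof
  assume indep: "matroid_indep (represented_matroid R E A) E"
  show "\<not> columns_dependent R A E"
  proof
    assume "columns_dependent R A E"
    then obtain C where "C \<in> circuits (represented_matroid R E A)"
      using columns_dependent_imp_circuit assms by blast
    then show False
      using indep by (auto simp: matroid_indep_def represented_matroid_def)
  qed
next
  assume "\<not> columns_dependent R A E"
  then show "matroid_indep (represented_matroid R E A) E"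
    using columns_dependent_mono[OF _ _ assms]
    by (auto simp: matroid_indep_def represented_matroid_def)
qed

text \<open>
  The circuits of a represented matroid are nonempty, so its empty set is independent and its rank
  is the maximum of a nonempty set. The rank reaches the size of the ground set only if the ground
  set itself is independent.
\<close>

lemma matroid_nullity_represented_eq_0_iff:
  assumes "finite E"
  shows "matroid_nullity (represented_matroid R E A) = 0 \<longleftrightarrow> \<not> columns_dependent R A E"
proof -
  let ?M = "represented_matroid R E A"
  let ?I = "{I. matroid_indep ?M I}"
  have ground: "ground ?M = E"
    by (simp add: represented_matroid_def)
  have sub: "I \<subseteq> E" if "I \<in> ?I" for I
    using that by (simp add: matroid_indep_def ground)
  have "finite ?I"
    using sub assms by (auto intro: finite_subset[of _ "Pow E"])
  moreover have "{} \<in> ?I"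
    by (auto simp: matroid_indep_def represented_matroid_def)
  ultimately have "card E \<le> matroid_rank ?M \<longleftrightarrow> (\<exists>I\<in>?I. card E \<le> card I)"
    unfolding matroid_rank_def by (subst Max_ge_iff) auto
  also have "\<dots> \<longleftrightarrow> matroid_indep ?M E"
  proof
    assume "\<exists>I\<in>?I. card E \<le> card I"
    then obtain I where "I \<in> ?I" "card E \<le> card I"
      by blast
    then show "matroid_indep ?M E"
      using sub card_seteq[OF assms, of I] by simp
  qed auto
  also have "\<dots> \<longleftrightarrow> \<not> columns_dependent R A E"
    by (rule matroid_indep_represented_ground_iff[OF assms])
  finally show ?thesis
    by (simp add: matroid_nullity_def ground)
qed

section \<open>Isomorphisms\<close>

lemma columns_dependent_reindex:
  assumes "inj_on f S" and "\<And>u v. u \<in> R \<Longrightarrow> v \<in> S \<Longrightarrow> A' (g u) (f v) = A u v"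
  shows "columns_dependent (g ` R) A' (f ` S) \<longleftrightarrow> columns_dependent R A S"
proof -
  have sum: "(\<Sum>y\<in>f ` S. c y * A' (g u) y) = (\<Sum>v\<in>S. c (f v) * A u v)" if "u \<in> R" for c u
    using assms that by (simp add: sum.reindex)
  show ?thesis
  proof
    assume "columns_dependent (g ` R) A' (f ` S)"
    then obtain c where "\<exists>v\<in>S. c (f v) \<noteq> 0" "\<forall>u\<in>R. (\<Sum>v\<in>S. c (f v) * A u v) = 0"
      using sum by (auto simp: columns_dependent_def)
    then show "columns_dependent R A S"
      unfolding columns_dependent_def by (intro exI[of _ "\<lambda>v. c (f v)"]) simp
  next
    assume "columns_dependent R A S"
    then obtain c where c: "\<exists>v\<in>S. c v \<noteq> 0" "\<forall>u\<in>R. (\<Sum>v\<in>S. c v * A u v) = 0"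
      by (auto simp: columns_dependent_def)
    define d where "d = c \<circ> the_inv_into S f"
    have d: "d (f v) = c v" if "v \<in> S" for v
      using the_inv_into_f_f[OF assms(1) that] by (simp add: d_def)
    have "(\<Sum>v\<in>S. d (f v) * A u v) = 0" if "u \<in> R" for u
      using c(2) that d by simp
    then show "columns_dependent (g ` R) A' (f ` S)"
      unfolding columns_dependent_def using c(1) d sum by (intro exI[of _ d]) auto
  qed
qed

lemma matroid_isomorphism_represented_matroid:
  assumes g: "g ` R = R'" and f: "bij_betw f E E'"
    and A: "\<And>u v. u \<in> R \<Longrightarrow> v \<in> E \<Longrightarrow> A' (g u) (f v) = A u v"
  shows "matroid_isomorphism (represented_matroid R E A) (represented_matroid R' E' A') f"
proof -
  have inj: "inj_on f E" and im: "f ` E = E'"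
    using f by (auto simp: bij_betw_def)
  have dep: "columns_dependent R' A' (f ` C) \<longleftrightarrow> columns_dependent R A C" if "C \<subseteq> E" for C
    using columns_dependent_reindex[of f C R A' g A] A that inj_on_subset[OF inj that]
    unfolding g by blast
  have circuit: "f ` C \<in> circuits (represented_matroid R' E' A') \<longleftrightarrow>
      C \<in> circuits (represented_matroid R E A)" if C: "C \<subseteq> E" for C
  proof -
    have "(\<forall>D. D \<subset> f ` C \<and> D \<noteq> {} \<longrightarrow> \<not> columns_dependent R' A' D) \<longleftrightarrow>
      (\<forall>D. D \<subset> C \<and> D \<noteq> {} \<longrightarrow> \<not> columns_dependent R A D)"
    proof (intro iffI allI impI)
      fix D assume *: "\<forall>D. D \<subset> f ` C \<and> D \<noteq> {} \<longrightarrow> \<not> columns_dependent R' A' D"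
        and D: "D \<subset> C \<and> D \<noteq> {}"
      then have "D \<subseteq> E" "f ` D \<noteq> {}"
        using C by auto
      moreover have "f ` D \<subset> f ` C"
        using D by (intro image_strict_mono[OF inj_on_subset[OF inj C]]) simp
      ultimately show "\<not> columns_dependent R A D"
        using * dep by blast
    next
      fix D assume *: "\<forall>D. D \<subset> C \<and> D \<noteq> {} \<longrightarrow> \<not> columns_dependent R A D"
        and D: "D \<subset> f ` C \<and> D \<noteq> {}"
      then obtain B where B: "B \<subseteq> C" "D = f ` B"
        by (meson psubset_imp_subset subset_imageE)
      then have "B \<subset> C" "B \<noteq> {}" "B \<subseteq> E"
        using D C by auto
      then show "\<not> columns_dependent R' A' D"
        using * dep B(2) by blast
    qed
    then show ?thesis
      using C im dep[OF C] by (auto simp: represented_matroid_def)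
  qed
  have "circuits (represented_matroid R' E' A') =
      (\<lambda>C. f ` C) ` circuits (represented_matroid R E A)"
  proof (intro equalityI subsetI)
    fix D assume D: "D \<in> circuits (represented_matroid R' E' A')"
    then have "D \<subseteq> f ` E"
      by (auto simp: represented_matroid_def im)
    then obtain C where "C \<subseteq> E" "D = f ` C"
      by (meson subset_imageE)
    then show "D \<in> (\<lambda>C. f ` C) ` circuits (represented_matroid R E A)"
      using D circuit by auto
  next
    fix D assume "D \<in> (\<lambda>C. f ` C) ` circuits (represented_matroid R E A)"
    then obtain C where C: "C \<in> circuits (represented_matroid R E A)" "D = f ` C"
      by auto
    then have "C \<subseteq> E"
      by (simp add: represented_matroid_def)
    then show "D \<in> circuits (represented_matroid R' E' A')"
      using C circuit by simp
  qed
  then show ?thesis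
    using f by (simp add: matroid_isomorphism_def represented_matroid_def)
qed

text \<open>
  Injectivity of \<open>f\<close> on the ground set makes \<open>f ` C \<subseteq> f ` I\<close> equivalent to \<open>C \<subseteq> I\<close>, so \<open>f\<close> matches
  up the independent sets of equal size. This argument is about circuits within the ground set,
  which the record type does not enforce.
\<close>

lemma matroid_nullity_eq_if_isomorphism:
  assumes iso: "matroid_isomorphism M N f" and circuits: "circuits M \<subseteq> Pow (ground M)"
  shows "matroid_nullity M = matroid_nullity N"
proof -
  have inj: "inj_on f (ground M)" and im: "f ` ground M = ground N"
    and circ: "circuits N = (\<lambda>C. f ` C) ` circuits M"
    using iso by (auto simp: matroid_isomorphism_def bij_betw_def)
  have indep: "matroid_indep N (f ` I) \<longleftrightarrow> matroid_indep M I" if I: "I \<subseteq> ground M" for I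
  proof -
    have "f ` C \<subseteq> f ` I \<longleftrightarrow> C \<subseteq> I" if "C \<in> circuits M" for C
    proof -
      have "C \<subseteq> ground M"
        using circuits that by blast
      then have "f x \<in> f ` I \<longleftrightarrow> x \<in> I" if "x \<in> C" for x
        using inj_on_image_mem_iff[OF inj _ I, of x] that by blast
      then show ?thesis
        by (simp add: image_subset_iff subset_eq[of C])
    qed
    moreover have "f ` I \<subseteq> ground N"
      using image_mono[OF I, of f] im by simp
    ultimately show ?thesis
      using I circ by (simp add: matroid_indep_def)
  qed
  have "{I. matroid_indep N I} = (\<lambda>I. f ` I) ` {I. matroid_indep M I}"
  proof (intro equalityI subsetI)
    fix J assume J: "J \<in> {I. matroid_indep N I}"
    then have "J \<subseteq> f ` ground M"
      by (simp add: matroid_indep_def im)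
    then obtain I where "I \<subseteq> ground M" "J = f ` I"
      by (meson subset_imageE)
    then show "J \<in> (\<lambda>I. f ` I) ` {I. matroid_indep M I}"
      using J indep by auto
  next
    fix J assume "J \<in> (\<lambda>I. f ` I) ` {I. matroid_indep M I}"
    then obtain I where I: "matroid_indep M I" "J = f ` I"
      by auto
    then have "I \<subseteq> ground M"
      by (simp add: matroid_indep_def)
    then show "J \<in> {I. matroid_indep N I}"
      using I indep by simp
  qed
  moreover have "card (f ` I) = card I" if "matroid_indep M I" for I
    using that inj by (auto simp: matroid_indep_def intro: card_image inj_on_subset)
  ultimately have "card ` {I. matroid_indep N I} = card ` {I. matroid_indep M I}"
    by (simp add: image_image)
  then show ?thesis
    using card_image[OF inj] im by (simp add: matroid_nullity_def matroid_rank_def)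
qed

section \<open>Dependence of one or two columns\<close>

lemma columns_dependent_singleton_iff: "columns_dependent {v} A {v} \<longleftrightarrow> A v v = 0"
  by (auto simp: columns_dependent_def intro: exI[of _ "\<lambda>_. 1"])

lemma columns_dependent_pair_iff:
  assumes "v \<noteq> w"
  shows "columns_dependent {v, w} A {v, w} \<longleftrightarrow> A v v * A w w = A v w * A w v"
proof -
  have dep: "columns_dependent {v, w} A {v, w} \<longleftrightarrow> (\<exists>x y. (x \<noteq> 0 \<or> y \<noteq> 0) \<and>
      x * A v v + y * A v w = 0 \<and> x * A w v + y * A w w = 0)" (is "_ \<longleftrightarrow> ?R")
  proof
    assume "columns_dependent {v, w} A {v, w}"
    then show ?R
      using assms by (auto simp: columns_dependent_def)
  next
    assume ?R
    then obtain x y where "x \<noteq> 0 \<or> y \<noteq> 0" "x * A v v + y * A v w = 0" "x * A w v + y * A w w = 0"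
      by blast
    then show "columns_dependent {v, w} A {v, w}"
      using assms by (auto simp: columns_dependent_def intro!: exI[of _ "\<lambda>u. if u = v then x else y"])
  qed
  show ?thesis
    unfolding dep
  proof
    assume ?R
    then obtain x y where xy: "x \<noteq> 0 \<or> y \<noteq> 0"
      and 1: "x * A v v + y * A v w = 0" and 2: "x * A w v + y * A w w = 0"
      by blast
    have "x * (A v v * A w w - A v w * A w v) =
        A w w * (x * A v v + y * A v w) - A v w * (x * A w v + y * A w w)"
      by (simp add: algebra_simps)
    moreover have "y * (A v v * A w w - A v w * A w v) =
        A v v * (x * A w v + y * A w w) - A w v * (x * A v v + y * A v w)"
      by (simp add: algebra_simps)
    ultimately show "A v v * A w w = A v w * A w v"
      using xy 1 2 by auto
  next
    assume det: "A v v * A w w = A v w * A w v"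
    \<comment> \<open>The matrix annihilates both columns of its adjugate, since the determinant is zero. If both
      columns vanish, the matrix is zero.\<close>
    consider "A w w \<noteq> 0 \<or> A w v \<noteq> 0" | "A v w \<noteq> 0 \<or> A v v \<noteq> 0"
      | "A v v = 0" "A v w = 0" "A w v = 0" "A w w = 0"
      by blast
    then show ?R
    proof cases
      case 1
      then show ?thesis
        using det by (intro exI[of _ "A w w"] exI[of _ "- A w v"]) (auto simp: algebra_simps)
    next
      case 2
      then show ?thesis
        using det by (intro exI[of _ "- A v w"] exI[of _ "A v v"]) (auto simp: algebra_simps)
    next
      case 3
      then show ?thesis
        by (intro exI[of _ 1]) auto
    qed
  qed
qed

section \<open>Full subgraphs\<close>

lemma adjacency_matrix_induce_subgraph:
  assumes "v \<in> S" "w \<in> S"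
  shows "adjacency_matrix (G \<restriction> S) v w = adjacency_matrix G v w"
proof -
  have "v \<rightarrow>\<^bsub>G \<restriction> S\<^esub> w \<longleftrightarrow> v \<rightarrow>\<^bsub>G\<^esub> w"
    using assms by (auto simp: arcs_ends_def arc_to_ends_def)
  then show ?thesis
    by (simp add: adjacency_matrix_def)
qed

lemma adjacency_matrix_eq_iff:
  "adjacency_matrix G v w = adjacency_matrix H x y \<longleftrightarrow> (v \<rightarrow>\<^bsub>G\<^esub> w \<longleftrightarrow> x \<rightarrow>\<^bsub>H\<^esub> y)"
  by (simp add: adjacency_matrix_def)

lemma adjacency_matroid_induce_subgraph:
  "adjacency_matroid (G \<restriction> S) = represented_matroid S S (adjacency_matrix (G \<restriction> S))"
  by (simp add: adjacency_matroid_def)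

lemma matroid_isomorphism_adjacency_matroid_induce_subgraph:
  assumes "graph_isomorphism G H f" "S \<subseteq> verts G"
  shows "matroid_isomorphism (adjacency_matroid (G \<restriction> S)) (adjacency_matroid (H \<restriction> (f ` S))) f"
  unfolding adjacency_matroid_induce_subgraph
proof (rule matroid_isomorphism_represented_matroid)
  show "bij_betw f S (f ` S)"
    using assms by (auto simp: graph_isomorphism_def bij_betw_def intro: inj_on_subset)
  show "adjacency_matrix (H \<restriction> (f ` S)) (f u) (f v) = adjacency_matrix (G \<restriction> S) u v"
    if "u \<in> S" "v \<in> S" for u v
    using assms that
    by (auto simp: adjacency_matrix_induce_subgraph adjacency_matrix_eq_iff graph_isomorphism_def)
qed simp

lemma nullity_induce_subgraph_singleton_eq_0_iff:
  "matroid_nullity (adjacency_matroid (G \<restriction> {v})) = 0 \<longleftrightarrow> v \<rightarrow>\<^bsub>G\<^esub> v"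
  by (simp add: adjacency_matroid_induce_subgraph matroid_nullity_represented_eq_0_iff
      columns_dependent_singleton_iff adjacency_matrix_induce_subgraph)
    (simp add: adjacency_matrix_def)

text \<open>
  Over the field with two elements, the determinant of a symmetric matrix with rows
  \<open>(a, b)\<close> and \<open>(b, d)\<close> is \<open>a d - b\<^sup>2 = a d - b\<close>.
\<close>

lemma nullity_induce_subgraph_pair_eq_0_iff:
  assumes "v \<noteq> w" "v \<rightarrow>\<^bsub>G\<^esub> w \<longleftrightarrow> w \<rightarrow>\<^bsub>G\<^esub> v"
  shows "matroid_nullity (adjacency_matroid (G \<restriction> {v, w})) = 0 \<longleftrightarrow>
    (v \<rightarrow>\<^bsub>G\<^esub> w \<longleftrightarrow> \<not> (v \<rightarrow>\<^bsub>G\<^esub> v \<and> w \<rightarrow>\<^bsub>G\<^esub> w))"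
proof -
  have "matroid_nullity (adjacency_matroid (G \<restriction> {v, w})) = 0 \<longleftrightarrow>
      adjacency_matrix G v v * adjacency_matrix G w w \<noteq>
      adjacency_matrix G v w * adjacency_matrix G w v"
    using assms(1) by (simp add: adjacency_matroid_induce_subgraph columns_dependent_pair_iff
        matroid_nullity_represented_eq_0_iff adjacency_matrix_induce_subgraph)
  then show ?thesis
    using assms(2)
    by (cases "v \<rightarrow>\<^bsub>G\<^esub> w"; cases "v \<rightarrow>\<^bsub>G\<^esub> v"; cases "w \<rightarrow>\<^bsub>G\<^esub> w")
      (simp_all add: adjacency_matrix_def)
qed

lemma graph_isomorphism_if_nullities_eq:
  assumes bij: "bij_betw f (verts G) (verts H)"
    and symG: "\<And>v w. v \<rightarrow>\<^bsub>G\<^esub> w \<Longrightarrow> w \<rightarrow>\<^bsub>G\<^esub> v" and symH: "\<And>v w. v \<rightarrow>\<^bsub>H\<^esub> w \<Longrightarrow> w \<rightarrow>\<^bsub>H\<^esub> v"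
    and nullity: "\<And>S. S \<subseteq> verts G \<Longrightarrow> card S \<le> 2 \<Longrightarrow>
      matroid_nullity (adjacency_matroid (G \<restriction> S)) =
      matroid_nullity (adjacency_matroid (H \<restriction> (f ` S)))"
  shows "graph_isomorphism G H f"
proof -
  have loop: "v \<rightarrow>\<^bsub>G\<^esub> v \<longleftrightarrow> f v \<rightarrow>\<^bsub>H\<^esub> f v" if "v \<in> verts G" for v
  proof -
    have "matroid_nullity (adjacency_matroid (G \<restriction> {v})) =
        matroid_nullity (adjacency_matroid (H \<restriction> {f v}))"
      using nullity[of "{v}"] that by simp
    then show ?thesis
      by (simp flip: nullity_induce_subgraph_singleton_eq_0_iff)
  qed
  have edge: "v \<rightarrow>\<^bsub>G\<^esub> w \<longleftrightarrow> f v \<rightarrow>\<^bsub>H\<^esub> f w"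
    if vw: "v \<in> verts G" "w \<in> verts G" and "v \<noteq> w" for v w
  proof -
    have "f v \<noteq> f w"
      using bij that by (auto simp: bij_betw_def inj_on_def)
    moreover have "matroid_nullity (adjacency_matroid (G \<restriction> {v, w})) =
        matroid_nullity (adjacency_matroid (H \<restriction> {f v, f w}))"
      using nullity[of "{v, w}"] that by simp
    ultimately have "(v \<rightarrow>\<^bsub>G\<^esub> w \<longleftrightarrow> \<not> (v \<rightarrow>\<^bsub>G\<^esub> v \<and> w \<rightarrow>\<^bsub>G\<^esub> w)) \<longleftrightarrow>
        (f v \<rightarrow>\<^bsub>H\<^esub> f w \<longleftrightarrow> \<not> (f v \<rightarrow>\<^bsub>H\<^esub> f v \<and> f w \<rightarrow>\<^bsub>H\<^esub> f w))"
      using nullity_induce_subgraph_pair_eq_0_iff[of v w G]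
        nullity_induce_subgraph_pair_eq_0_iff[of "f v" "f w" H] \<open>v \<noteq> w\<close> symG symH by metis
    then show ?thesis
      using loop vw by blast
  qed
  show ?thesis
    unfolding graph_isomorphism_def using bij loop edge by metis
qed

theorem theorem7:
  fixes G :: "'a pair_pre_digraph" and G' :: "'b pair_pre_digraph" and f :: "'a \<Rightarrow> 'b"
  assumes "pair_pseudo_graph G" and "pair_pseudo_graph G'"
    and "bij_betw f (pverts G) (pverts G')"
  shows "(graph_isomorphism (with_proj G) (with_proj G') f \<longleftrightarrow>
            (\<forall>S \<subseteq> pverts G.
               matroid_isomorphism (adjacency_matroid (with_proj G \<restriction> S))
                 (adjacency_matroid (with_proj G' \<restriction> (f ` S))) f))
       \<and> (graph_isomorphism (with_proj G) (with_proj G') f \<longleftrightarrow>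
            (\<forall>S \<subseteq> pverts G. card S \<le> 2 \<longrightarrow>
               matroid_nullity (adjacency_matroid (with_proj G \<restriction> S)) =
               matroid_nullity (adjacency_matroid (with_proj G' \<restriction> (f ` S)))))"
    (is "(?iso \<longleftrightarrow> ?matroids) \<and> (?iso \<longleftrightarrow> ?nullities)")
proof -
  interpret G: pair_pseudo_graph G by fact
  interpret G': pair_pseudo_graph G' by fact
  have "?matroids" if ?iso
    using matroid_isomorphism_adjacency_matroid_induce_subgraph[OF that] by simp
  moreover have "?nullities" if ?matroids
  proof (intro allI impI)
    fix S assume "S \<subseteq> pverts G"
    with that have "matroid_isomorphism (adjacency_matroid (with_proj G \<restriction> S))
        (adjacency_matroid (with_proj G' \<restriction> (f ` S))) f"
      by blast
    then show "matroid_nullity (adjacency_matroid (with_proj G \<restriction> S)) =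
        matroid_nullity (adjacency_matroid (with_proj G' \<restriction> (f ` S)))"
      by (rule matroid_nullity_eq_if_isomorphism)
        (auto simp: adjacency_matroid_def represented_matroid_def)
  qed
  moreover have "?iso" if ?nullities
  proof (rule graph_isomorphism_if_nullities_eq)
    show "bij_betw f (verts (with_proj G)) (verts (with_proj G'))"
      using assms(3) by simp
    show "w \<rightarrow>\<^bsub>with_proj G\<^esub> v" if "v \<rightarrow>\<^bsub>with_proj G\<^esub> w" for v w
      using that by (rule arcs_ends_symmetric[OF G.sym_arcs])
    show "w \<rightarrow>\<^bsub>with_proj G'\<^esub> v" if "v \<rightarrow>\<^bsub>with_proj G'\<^esub> w" for v w
      using that by (rule arcs_ends_symmetric[OF G'.sym_arcs])
    show "matroid_nullity (adjacency_matroid (with_proj G \<restriction> S)) =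
        matroid_nullity (adjacency_matroid (with_proj G' \<restriction> (f ` S)))"
      if "S \<subseteq> verts (with_proj G)" "card S \<le> 2" for S
      using that \<open>?nullities\<close> by simp
  qed
  ultimately show ?thesis
    by blast
qed

end
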